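(* For all positive integers $r\ge2$, $t\ge2$ and $n$ there exists an $r$-uniform hypergraph $H=(V,E)$ with $|V|=n$ and \[ \delta_{r-1}(H)\ge\frac{n}{(r-1)t+1}-1 \] that has no $t$-shallow hitting edge set.
   Context: A hypergraph $H=(V,E)$ has a finite vertex set and a finite multiset of edges (subsets of $V$); it is $r$-uniform if each edge has $r$ vertices. For an $(r-1)$-set $\hat e\subseteq V$, $N_{r-1}(\hat e)$ is the set of vertices $v$ such that $\hat e\cup\{v\}$ is an edge of $H$, and $\delta_{r-1}(H)$ is the minimum of $|N_{r-1}(\hat e)|$ over all $(r-1)$-subsets $\hat e$ of $V$. For $M\subseteq E$, $\deg_M(v)$ is the number of edges of $M$ containing $v$; $M$ is hitting if $\deg_M(v)\ge1$ for all $v$, and $t$-shallow if $\deg_M(v)\le t$ for all $v$. *)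

theory Defs
  imports Complex_Main "HOL-Library.Multiset"
begin

record 'a hypergraph =
  verts :: "'a set"
  edges :: "'a set multiset"

definition wf_hypergraph :: "'a hypergraph \<Rightarrow> bool" where
  "wf_hypergraph H \<longleftrightarrow> finite (verts H) \<and> (\<forall>e \<in># edges H. e \<subseteq> verts H)"

definition uniform :: "nat \<Rightarrow> 'a hypergraph \<Rightarrow> bool" where
  "uniform r H \<longleftrightarrow> (\<forall>e \<in># edges H. card e = r)"

definition nbhd :: "'a hypergraph \<Rightarrow> 'a set \<Rightarrow> 'a set" where
  "nbhd H S = {v \<in> verts H. S \<union> {v} \<in># edges H}"

text \<open>
  For \<open>k = r - 1\<close> and an \<open>r\<close>-uniform hypergraph this is \<open>\<delta>\<^sub>k(H)\<close>; uniformity forces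
  the vertices of \<open>nbhd H S\<close> to lie outside \<open>S\<close> when \<open>card S = r - 1\<close>.
  If there are fewer than \<open>k\<close> vertices, the minimum ranges over the empty set, and the
  infimum on \<open>nat\<close> makes it \<open>0\<close> (the least possible value, so the strictest convention
  for lower bounds).
\<close>
definition min_codegree :: "nat \<Rightarrow> 'a hypergraph \<Rightarrow> nat" where
  "min_codegree k H = (INF S \<in> {S. S \<subseteq> verts H \<and> card S = k}. card (nbhd H S))"

text \<open>Edges are counted with multiplicity.\<close>
definition deg :: "'a set multiset \<Rightarrow> 'a \<Rightarrow> nat" where
  "deg M v = size {#e \<in># M. v \<in> e#}"

definition hitting :: "'a hypergraph \<Rightarrow> 'a set multiset \<Rightarrow> bool" where
  "hitting H M \<longleftrightarrow> (\<forall>v \<in> verts H. deg M v \<ge> 1)"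

definition shallow :: "nat \<Rightarrow> 'a hypergraph \<Rightarrow> 'a set multiset \<Rightarrow> bool" where
  "shallow t H M \<longleftrightarrow> (\<forall>v \<in> verts H. deg M v \<le> t)"

end

theory Submission
  imports Defs
begin

text \<open>
  Fix a vertex set \<open>A\<close> with fewer than \<open>n / ((r - 1) * t + 1)\<close> elements and take as edges all
  \<open>r\<close>-sets that meet \<open>A\<close>. The vertices of \<open>A\<close> lie on at most \<open>t * card A\<close> edges of a \<open>t\<close>-shallow
  edge set, and each edge covers at most \<open>r - 1\<close> vertices outside \<open>A\<close>, too few to hit all of them.
\<close>

text \<open>Double counting of incidences, with repeated edges counted each time. It is used once
  for the vertices outside \<open>A\<close>, where hitting bounds the degrees below, and once for
  \<open>A\<close>, where shallowness bounds them above.\<close>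

lemma sum_deg_eq_sum_card_Int:
  assumes "finite X"
  shows "(\<Sum>v\<in>X. deg M v) = (\<Sum>e\<in>#M. card (e \<inter> X))"
proof (induction M)
  case empty
  show ?case by (simp add: deg_def)
next
  case (add e M)
  have "deg (add_mset e M) v = (if v \<in> e then 1 else 0) + deg M v" for v
    by (simp add: deg_def)
  moreover have "(\<Sum>v\<in>X. if v \<in> e then 1 else 0) = card (e \<inter> X)"
    using assms by (simp add: sum.If_cases Int_commute Int_def)
  ultimately show ?case
    using add by (simp add: sum.distrib)
qed

definition meeting_hypergraph :: "nat \<Rightarrow> 'a set \<Rightarrow> 'a set \<Rightarrow> 'a hypergraph" where
  "meeting_hypergraph r V A =
     \<lparr>verts = V, edges = mset_set {e. e \<subseteq> V \<and> card e = r \<and> e \<inter> A \<noteq> {}}\<rparr>"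

lemma verts_meeting_hypergraph [simp]: "verts (meeting_hypergraph r V A) = V"
  by (simp add: meeting_hypergraph_def)

lemma in_edges_meeting_hypergraph [simp]:
  assumes "finite V"
  shows "e \<in># edges (meeting_hypergraph r V A) \<longleftrightarrow> e \<subseteq> V \<and> card e = r \<and> e \<inter> A \<noteq> {}"
proof -
  have "finite {e. e \<subseteq> V \<and> card e = r \<and> e \<inter> A \<noteq> {}}"
    using assms by simp
  then show ?thesis
    by (simp add: meeting_hypergraph_def)
qed

text \<open>If \<open>S\<close> misses \<open>A\<close>, each vertex of \<open>A\<close> completes
  \<open>S\<close> to an edge. If \<open>S\<close> already meets \<open>A\<close>, every vertex
  outside \<open>S\<close> does, and \<open>room\<close> says that there are at least
  \<open>card A\<close> of these.\<close>

lemma card_nbhd_meeting_hypergraph_ge: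
  assumes V: "finite V" "A \<subseteq> V" and S: "S \<subseteq> V" "Suc (card S) = r"
    and room: "card A + card S \<le> card V"
  shows "card A \<le> card (nbhd (meeting_hypergraph r V A) S)"
proof -
  let ?N = "nbhd (meeting_hypergraph r V A) S"
  have fin: "finite S" "finite ?N"
    using V S by (auto simp: nbhd_def intro: finite_subset)
  show ?thesis
  proof (cases "S \<inter> A = {}")
    case True
    then have "A \<subseteq> ?N"
      using V S fin by (auto simp: nbhd_def card_insert_if)
    then show ?thesis
      using fin card_mono by blast
  next
    case False
    have "V - S \<subseteq> ?N"
      using V S fin False by (auto simp: nbhd_def card_insert_if)
    then have "card (V - S) \<le> card ?N"
      using fin card_mono by blast
    then show ?thesis
      using room S fin by (simp add: card_Diff_subset)
  qed
qed

lemma min_codegree_meeting_hypergraph_ge: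
  assumes "finite V" "A \<subseteq> V" and room: "card A + k \<le> card V"
  shows "card A \<le> min_codegree k (meeting_hypergraph (Suc k) V A)"
proof -
  \<comment> \<open>An infimum over the empty set would be 0, so the lower bound needs some
    \<open>k\<close>-subset of \<open>V\<close> to exist.\<close>
  obtain S where "S \<subseteq> V" "card S = k"
    using room obtain_subset_with_card_n[of k V] by auto
  then show ?thesis
    unfolding min_codegree_def using assms
    by (intro cINF_greatest) (auto intro!: card_nbhd_meeting_hypergraph_ge)
qed

lemma hitting_shallow_meeting_hypergraph:
  assumes V: "finite V" "A \<subseteq> V"
    and M: "M \<subseteq># edges (meeting_hypergraph (Suc k) V A)"
    and hit: "hitting (meeting_hypergraph (Suc k) V A) M"
    and sh: "shallow t (meeting_hypergraph (Suc k) V A) M"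
  shows "card V \<le> (k * t + 1) * card A"
proof -
  have fin: "finite A" "finite (V - A)"
    using V by (auto intro: finite_subset)
  \<comment> \<open>An edge has at most \<open>k\<close> vertices outside \<open>A\<close> because
    it has at least one inside. Keeping the factor \<open>card (e \<inter> A)\<close> instead of 1
    lets the sum over \<open>M\<close> turn directly into a sum of degrees over \<open>A\<close>,
    with no separate bound on the size of \<open>M\<close>.\<close>
  have edge: "card (e \<inter> (V - A)) \<le> k * card (e \<inter> A)" if "e \<in># M" for e
  proof -
    have e: "e \<subseteq> V" "card e = Suc k" "e \<inter> A \<noteq> {}"
      using mset_subset_eqD[OF M that] V by auto
    have fine: "finite e"
      using e V finite_subset by blast
    have "card (e \<inter> A) + card (e \<inter> (V - A)) = card ((e \<inter> A) \<union> (e \<inter> (V - A)))"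
      using fine by (subst card_Un_disjoint) auto
    also have "(e \<inter> A) \<union> (e \<inter> (V - A)) = e"
      using e by auto
    finally have "card (e \<inter> A) + card (e \<inter> (V - A)) = Suc k"
      using e by simp
    moreover have "1 \<le> card (e \<inter> A)"
      using e fine by (simp add: Suc_le_eq card_gt_0_iff)
    moreover have "k * 1 \<le> k * card (e \<inter> A)"
      using calculation(2) by (rule mult_le_mono2)
    ultimately show ?thesis
      by linarith
  qed
  have "card (V - A) = (\<Sum>v\<in>V - A. 1)"
    by simp
  also have "\<dots> \<le> (\<Sum>v\<in>V - A. deg M v)"
    using hit by (intro sum_mono) (auto simp: hitting_def)
  also have "\<dots> = (\<Sum>e\<in>#M. card (e \<inter> (V - A)))"
    using fin by (simp add: sum_deg_eq_sum_card_Int)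
  also have "\<dots> \<le> (\<Sum>e\<in>#M. k * card (e \<inter> A))"
    using edge by (rule sum_mset_mono)
  also have "\<dots> = k * (\<Sum>v\<in>A. deg M v)"
    using fin by (simp add: sum_deg_eq_sum_card_Int sum_mset_distrib_left)
  also have "\<dots> \<le> k * (\<Sum>v\<in>A. t)"
    using sh V by (intro mult_le_mono2 sum_mono) (auto simp: shallow_def)
  finally have "card (V - A) \<le> k * t * card A"
    by (simp add: mult_ac)
  moreover have "card (V - A) = card V - card A"
    using V fin by (simp add: card_Diff_subset)
  ultimately show ?thesis
    by (simp add: algebra_simps)
qed

theorem theorem4p2:
  fixes r t n :: nat
  assumes "r \<ge> 2" and "t \<ge> 2" and "n \<ge> 1"
  shows "\<exists>H :: nat hypergraph.
           wf_hypergraph H \<and> uniform r H \<and> card (verts H) = n \<and>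
           real (min_codegree (r - 1) H) \<ge> real n / ((real r - 1) * real t + 1) - 1 \<and>
           \<not> (\<exists>M. M \<subseteq># edges H \<and> hitting H M \<and> shallow t H M)"
proof -
  obtain k where r: "r = Suc k"
    using assms by (cases r) auto
  define D where "D = k * t + 1"
  \<comment> \<open>The largest \<open>a\<close> with \<open>D * a < n\<close>. Dividing
    \<open>n - 1\<close> rather than \<open>n\<close> makes this inequality strict, which
    contradicts the bound \<open>n \<le> D * a\<close> forced by a shallow hitting set; maximality
    gives \<open>n \<le> D * (a + 1)\<close>, hence the codegree bound.\<close>
  define a where "a = (n - 1) div D"
  have "D > 0"
    by (simp add: D_def)
  then have "D * a \<le> n - 1" and upper: "n - 1 < D * Suc a"
    unfolding a_def using dividend_less_times_div[of D "n - 1"] by auto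
  then have lower: "D * a < n"
    using assms by linarith
  then have "a < n"
    by (simp add: D_def)
  define V where "V = {..<n}"
  define A where "A = {..<a}"
  define H where "H = meeting_hypergraph r V A"
  have VA: "finite V" "A \<subseteq> V" "card V = n" "card A = a"
    using \<open>a < n\<close> by (auto simp: V_def A_def)
  have "a \<le> min_codegree k H"
  \<comment> \<open>For \<open>a = 0\<close> there may be fewer than \<open>k\<close> vertices, but
    the claim is trivial. For \<open>a \<ge> 1\<close> the room for \<open>A\<close> and a
    \<open>k\<close>-set comes from \<open>D * a = k * t * a + a \<ge> k + a\<close>.\<close>
  proof (cases "a = 0")
    case False
    then have "k * 1 \<le> k * (t * a)"
      using assms by (intro mult_le_mono2) simp
    moreover have "D * a = k * (t * a) + a"
      by (simp add: D_def algebra_simps)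
    ultimately have "a + k \<le> n"
      using lower by linarith
    then show ?thesis
      using min_codegree_meeting_hypergraph_ge[of V A k] VA by (simp add: H_def r)
  qed simp
  moreover have "real n / real D \<le> real a + 1"
  proof -
    have "n \<le> D * (a + 1)"
      using upper by simp
    then have "real n \<le> real D * (real a + 1)"
      by (metis of_nat_1 of_nat_add of_nat_le_iff of_nat_mult)
    then show ?thesis
      using \<open>D > 0\<close> by (simp add: divide_le_eq mult.commute)
  qed
  moreover have "(real r - 1) * real t + 1 = real D"
    by (simp add: r D_def)
  ultimately have "real n / ((real r - 1) * real t + 1) - 1 \<le> real (min_codegree (r - 1) H)"
    by (simp add: r)
  moreover have "wf_hypergraph H" "uniform r H" "card (verts H) = n"
    using VA by (auto simp: wf_hypergraph_def uniform_def H_def)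
  moreover have "\<not> (\<exists>M. M \<subseteq># edges H \<and> hitting H M \<and> shallow t H M)"
    using hitting_shallow_meeting_hypergraph[of V A _ k t] VA lower
    by (auto simp: H_def r D_def)
  ultimately show ?thesis
    by blast
qed

end
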